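(* Let $(b(n))_{n\ge 0}=(B_0,-B_1,-B_1,B_2,B_2,-B_3,-B_3,\dots)=(1,-2,-2,6,6,-20,-20,70,70,\dots)$, i.e. $b(0)=1$ and $b(2m-1)=b(2m)=(-1)^m B_m$ for $m\ge 1$, where $B_m=\binom{2m}{m}$. Then for all integers $n\ge 0$ $$\det\bigl(b(i+j)\bigr)_{i,j=0}^{n-1}=(-1)^{\binom n2}2^{n-1}L_n$$ and $$\det\bigl(b(i+j+1)\bigr)_{i,j=0}^{n-1}=(-1)^{\binom{n+1}2}2^{n}L_{2\lfloor n/2\rfloor+1}.$$
   Context: $L_n$ is the Lucas sequence $L_0=2$, $L_1=1$, $L_n=L_{n-1}+L_{n-2}$. The determinant of the empty ($0\times 0$) matrix is $1$ (so for $n=0$ the first formula reads $2^{-1}L_0=1$). *)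

theory Defs
  imports "Jordan_Normal_Form.Determinant"
begin

fun lucas :: "nat \<Rightarrow> int" where
  "lucas 0 = 2"
| "lucas (Suc 0) = 1"
| "lucas (Suc (Suc n)) = lucas (Suc n) + lucas n"

definition central_binom :: "nat \<Rightarrow> nat" where
  "central_binom m = (2 * m) choose m"

text \<open>The index \<open>(n + 1) div 2\<close> equals \<open>m\<close> both for \<open>n = 2 m - 1\<close> and for \<open>n = 2 m\<close>;
  the lemmas below give the defining equations of the sequence.\<close>

definition b :: "nat \<Rightarrow> int" where
  "b n = (-1) ^ ((n + 1) div 2) * int (central_binom ((n + 1) div 2))"

lemma b_zero: "b 0 = 1"
  by (simp add: b_def central_binom_def)

lemma b_odd: "m \<ge> 1 \<Longrightarrow> b (2 * m - 1) = (-1) ^ m * int (central_binom m)"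
  by (simp add: b_def)

lemma b_even: "b (2 * m) = (-1) ^ m * int (central_binom m)"
  by (simp add: b_def)

end

theory Submission
  imports Defs
begin

text \<open>
  Let \<open>M\<close> be the linear functional sending \<open>x\<^sup>n\<close> to the constant term of \<open>(z - 1/z)\<^sup>n\<close>. Then
  \<open>b n = M (x\<^sup>n (1 + x))\<close>, and the orthogonal polynomials of \<open>M\<close> are the Lucas polynomials
  \<open>\<ell>\<^sub>k = z\<^sup>k + (-1/z)\<^sup>k\<close>, of norm \<open>2 (-1)\<^sup>k\<close> for \<open>k \<ge> 1\<close> and with \<open>\<ell>\<^sub>k(-1) = (-1)\<^sup>k L\<^sub>k\<close>. Multiply the
  Hankel matrix of \<open>M\<close> of size \<open>n + 1\<close> by the matrix whose columns are the coefficients of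
  \<open>(1 + x) x\<^sup>j\<close>, \<open>j < n\<close>, and of one further polynomial \<open>q\<close>; the latter matrix has determinant
  \<open>(-1)\<^sup>n q(-1)\<close>. For \<open>q = \<ell>\<^sub>n\<close> the last column of the product is supported in the last row, which
  yields the first formula. For \<open>q = 1 + \<ell>\<^sub>2 + \<ell>\<^sub>4 + \<dots>\<close>, the reproducing kernel of \<open>M\<close> at \<open>0\<close>, it is
  supported in the first row, which yields the second.
\<close>

section \<open>Laurent coefficients of powers of z - 1/z\<close>

text \<open>The coefficient of \<open>z\<^sup>-\<^sup>k\<close> in \<open>(z - 1/z)\<^sup>i\<close>; thus \<open>laurent_coeff i 0\<close> is the moment \<open>M (x\<^sup>i)\<close>.\<close>

definition laurent_coeff :: "nat \<Rightarrow> nat \<Rightarrow> int" where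
  "laurent_coeff i k =
     (if even (i + k) then (-1) ^ ((i + k) div 2) * int (i choose ((i + k) div 2)) else 0)"

lemma laurent_coeff_eq_0: "i < k \<Longrightarrow> laurent_coeff i k = 0"
proof -
  assume "i < k"
  then have "even (i + k) \<Longrightarrow> i < (i + k) div 2" by presburger
  then show ?thesis by (simp add: laurent_coeff_def binomial_eq_0)
qed

lemma laurent_coeff_diag: "laurent_coeff k k = (-1) ^ k"
proof -
  have "(k + k) div 2 = k" by simp
  then show ?thesis by (simp add: laurent_coeff_def)
qed

text \<open>Multiply \<open>(z - 1/z)^i\<close> by z - 1/z and compare coefficients of
  \<open>z^(-k-1)\<close>.\<close>

lemma laurent_coeff_rec:
  "laurent_coeff i (Suc (Suc k)) = laurent_coeff (Suc i) (Suc k) + laurent_coeff i k"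
proof (cases "even (i + k)")
  case True
  then obtain s where "i + k = 2 * s" by (elim evenE)
  then have "(i + k) div 2 = s" "(i + Suc (Suc k)) div 2 = Suc s" "(Suc i + Suc k) div 2 = Suc s"
    by simp_all
  with True show ?thesis
    unfolding laurent_coeff_def by (simp del: add_Suc_right add_Suc add: algebra_simps)
qed (simp add: laurent_coeff_def)

text \<open>z - 1/z is invariant under z -> -1/z, so the coefficients of z and 1/z in its powers are
  opposite and contribute equally.\<close>

lemma laurent_coeff_Suc_0: "laurent_coeff (Suc i) 0 = 2 * laurent_coeff i 1"
proof (cases "even (Suc i)")
  case True
  then obtain s where "Suc i = 2 * s" by (elim evenE)
  then obtain t where i: "i = 2 * t + 1" by (cases s) auto
  have "Suc (2 * t + 1) choose Suc t = 2 * (2 * t + 1 choose Suc t)"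
    using binomial_symmetric[of t "2 * t + 1"] by simp
  then show ?thesis
    by (simp add: laurent_coeff_def i)
qed (simp add: laurent_coeff_def)

text \<open>Odd moments vanish, so only the summand of even index survives; hence the equal pairs in
  \<open>b\<close>.\<close>

lemma b_eq_laurent_coeff: "b n = laurent_coeff n 0 + laurent_coeff (Suc n) 0"
proof (cases "even n")
  case True
  then show ?thesis by (auto simp: b_def central_binom_def laurent_coeff_def)
next
  case False
  then have "2 * (Suc n div 2) = Suc n" by simp
  with False show ?thesis by (simp add: b_def central_binom_def laurent_coeff_def)
qed

section \<open>Lucas polynomials and their moments\<close>

fun lucas_poly :: "nat \<Rightarrow> int poly" where
  "lucas_poly 0 = [:2:]"
| "lucas_poly (Suc 0) = [:0, 1:]"
| "lucas_poly (Suc (Suc n)) = pCons 0 (lucas_poly (Suc n)) + lucas_poly n"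

lemma degree_lucas_poly_le: "degree (lucas_poly n) \<le> n"
  by (induction n rule: lucas_poly.induct) (auto intro!: degree_add_le degree_pCons_le[THEN le_trans])

lemma coeff_lucas_poly_self: "coeff (lucas_poly (Suc n)) (Suc n) = 1"
proof (induction n)
  case (Suc n)
  have "coeff (lucas_poly n) (Suc (Suc n)) = 0"
    using degree_lucas_poly_le[of n] by (intro coeff_eq_0) simp
  with Suc show ?case by simp
qed simp

lemma poly_lucas_poly_minus_1: "poly (lucas_poly n) (-1) = (-1) ^ n * lucas n"
  by (induction n rule: lucas_poly.induct) (auto simp: algebra_simps)

text \<open>The value \<open>M (x\<^sup>i p)\<close>, provided that \<open>degree p < n\<close>.\<close>

definition moment :: "nat \<Rightarrow> nat \<Rightarrow> int poly \<Rightarrow> int" where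
  "moment n i p = (\<Sum>j<n. laurent_coeff (i + j) 0 * coeff p j)"

lemma moment_add: "moment n i (p + q) = moment n i p + moment n i q"
  by (simp add: moment_def distrib_left sum.distrib)

lemma moment_pCons:
  "moment (Suc n) i (pCons a p) = laurent_coeff i 0 * a + moment n (Suc i) p"
  unfolding moment_def by (subst sum.lessThan_Suc_shift) simp

lemma moment_0: "moment n i 0 = 0"
  by (simp add: moment_def)

text \<open>By the symmetry z -> -1/z, both terms of \<open>z^k + (-1/z)^k\<close> contribute the
  same coefficient. Vanishing for i < k is orthogonality.\<close>

lemma moment_lucas_poly: "k < n \<Longrightarrow> moment n i (lucas_poly k) = 2 * laurent_coeff i k"
proof (induction k arbitrary: n i rule: lucas_poly.induct)
  case 1
  then show ?case by (cases n) (auto simp: moment_pCons moment_0)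
next
  case 2
  then obtain m where "n = Suc (Suc m)" by (auto simp: numeral_2_eq_2 dest!: less_imp_Suc_add)
  then show ?case by (simp add: moment_pCons moment_0 laurent_coeff_Suc_0)
next
  case (3 k)
  then obtain m where "n = Suc m" by (cases n) auto
  with 3 show ?case by (simp add: moment_add moment_pCons laurent_coeff_rec)
qed

text \<open>All kernel coefficients are 1: at x = 0 the even Lucas polynomials of positive index
  take the value 2, which is their norm, and the odd ones vanish.\<close>

fun kernel_poly :: "nat \<Rightarrow> int poly" where
  "kernel_poly 0 = 1"
| "kernel_poly (Suc m) = kernel_poly m + lucas_poly (2 * m + 2)"

lemma degree_kernel_poly_le: "degree (kernel_poly m) \<le> 2 * m"
  by (induction m) (auto intro!: degree_add_le degree_lucas_poly_le[THEN le_trans]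
      simp del: lucas_poly.simps)

lemma poly_kernel_poly_minus_1: "poly (kernel_poly m) (-1) = lucas (2 * m + 1)"
  by (induction m) (simp_all add: poly_lucas_poly_minus_1 del: lucas_poly.simps)

lemma moment_kernel_poly_0: "2 * m < n \<Longrightarrow> moment n 0 (kernel_poly m) = 1"
proof (induction m)
  case 0
  then show ?case by (cases n) (auto simp: one_pCons moment_pCons moment_0 laurent_coeff_def)
next
  case (Suc m)
  then show ?case
    by (simp add: moment_add moment_lucas_poly laurent_coeff_eq_0 del: lucas_poly.simps)
qed

text \<open>The recurrence of the Laurent coefficients makes this sum telescope.\<close>

lemma moment_kernel_poly_Suc:
  "2 * m < n \<Longrightarrow> moment n (Suc i) (kernel_poly m) = 2 * laurent_coeff i (2 * m + 1)"
proof (induction m)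
  case 0
  then show ?case by (cases n) (auto simp: one_pCons moment_pCons moment_0 laurent_coeff_Suc_0)
next
  case (Suc m)
  then show ?case
    using laurent_coeff_rec[of i "2 * m + 1"]
    by (simp add: moment_add moment_lucas_poly del: lucas_poly.simps)
qed

text \<open>For positive i, the bound \<open>i - 1 < n \<le> 2 * (n div 2) + 1\<close> makes the
  Laurent coefficient vanish, for either parity of n.\<close>

lemma moment_kernel_poly:
  assumes "i \<le> n"
  shows "moment (Suc n) i (kernel_poly (n div 2)) = (if i = 0 then 1 else 0)"
  using assms
  by (cases i) (auto simp: moment_kernel_poly_0 moment_kernel_poly_Suc laurent_coeff_eq_0)

section \<open>Hankel determinants of the moments\<close>

lemma det_last_col_single:
  fixes f :: "nat \<Rightarrow> nat \<Rightarrow> 'a :: comm_ring_1"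
  assumes "r \<le> n" and "\<And>i. i \<le> n \<Longrightarrow> f i n = (if i = r then c else 0)"
  shows "det (mat (Suc n) (Suc n) (\<lambda>(i, j). f i j)) =
    c * (-1) ^ (r + n) * det (mat n n (\<lambda>(i, j). f (if i < r then i else Suc i) j))"
proof -
  let ?A = "mat (Suc n) (Suc n) (\<lambda>(i, j). f i j)"
  have "det ?A = (\<Sum>i<Suc n. ?A $$ (i, n) * cofactor ?A i n)"
    by (rule laplace_expansion_column) auto
  also have "\<dots> = (\<Sum>i<Suc n. if i = r then c * cofactor ?A i n else 0)"
    by (rule sum.cong) (auto simp: assms(2))
  also have "\<dots> = c * cofactor ?A r n"
    using assms(1) by simp
  also have "mat_delete ?A r n = mat n n (\<lambda>(i, j). f (if i < r then i else Suc i) j)"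
    by (rule eq_matI) (auto simp: mat_delete_def)
  then have "c * cofactor ?A r n =
      c * (-1) ^ (r + n) * det (mat n n (\<lambda>(i, j). f (if i < r then i else Suc i) j))"
    by (simp add: cofactor_def)
  finally show ?thesis .
qed

abbreviation moment_mat :: "nat \<Rightarrow> int mat" where
  "moment_mat n \<equiv> mat n n (\<lambda>(i, j). laurent_coeff (i + j) 0)"

lemma det_moment_mat_Suc:
  "det (moment_mat (Suc (Suc n))) = 2 * (-1) ^ Suc n * det (moment_mat (Suc n))"
proof -
  let ?m = "Suc n"
  \<comment> \<open>Unitriangular because the Lucas polynomial is monic.\<close>
  let ?R = "mat (Suc ?m) (Suc ?m) (\<lambda>(i, j). if j < ?m then (if i = j then 1 else 0)
      else coeff (lucas_poly ?m) i)"
  let ?f = "\<lambda>i j. if j < ?m then laurent_coeff (i + j) 0 else moment (Suc ?m) i (lucas_poly ?m)"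
  have "moment_mat (Suc ?m) * ?R = mat (Suc ?m) (Suc ?m) (\<lambda>(i, j). ?f i j)"
  proof (rule eq_matI)
    fix i j assume "i < dim_row (mat (Suc ?m) (Suc ?m) (\<lambda>(i, j). ?f i j))"
      "j < dim_col (mat (Suc ?m) (Suc ?m) (\<lambda>(i, j). ?f i j))"
    then show "(moment_mat (Suc ?m) * ?R) $$ (i, j) = mat (Suc ?m) (Suc ?m) (\<lambda>(i, j). ?f i j) $$ (i, j)"
      by (auto simp: scalar_prod_def moment_def atLeast0LessThan if_distrib[of "\<lambda>x. _ * x"]
          sum.delta cong: if_cong simp del: lucas_poly.simps sum.lessThan_Suc)
  qed auto
  moreover have "det ?R = prod_list (diag_mat ?R)"
    by (rule det_upper_triangular) (auto simp: upper_triangular_def)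
  then have "det ?R = 1"
    using coeff_lucas_poly_self[of n]
    by (simp add: prod_list_diag_prod atLeast0LessThan prod.lessThan_Suc del: lucas_poly.simps)
  moreover have "det (moment_mat (Suc ?m) * ?R) = det (moment_mat (Suc ?m)) * det ?R"
    by (rule det_mult) auto
  moreover have "det (mat (Suc ?m) (Suc ?m) (\<lambda>(i, j). ?f i j)) =
      2 * (-1) ^ ?m * (-1) ^ (?m + ?m) *
      det (mat ?m ?m (\<lambda>(i, j). ?f (if i < ?m then i else Suc i) j))"
    by (rule det_last_col_single)
      (auto simp: moment_lucas_poly laurent_coeff_diag laurent_coeff_eq_0 simp del: lucas_poly.simps)
  moreover have "mat ?m ?m (\<lambda>(i, j). ?f (if i < ?m then i else Suc i) j) = moment_mat ?m"
    by (rule eq_matI) auto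
  ultimately show ?thesis by (simp add: power_add[symmetric])
qed

lemma det_moment_mat: "det (moment_mat (Suc n)) = (-1) ^ (Suc n choose 2) * 2 ^ n"
proof (induction n)
  case 0
  show ?case by (simp add: det_single laurent_coeff_def numeral_2_eq_2)
next
  case (Suc n)
  have "Suc (Suc n) choose 2 = Suc n + (Suc n choose 2)"
    by (simp add: numeral_2_eq_2)
  with Suc show ?case by (simp add: det_moment_mat_Suc power_add)
qed

section \<open>Multiplication by 1 + x\<close>

lemma alt_sum_coeff_eq_poly_minus_1:
  fixes q :: "'a :: comm_ring_1 poly"
  assumes "degree q \<le> n"
  shows "(\<Sum>l\<le>n. (-1) ^ (n - l) * coeff q l) = (-1) ^ n * poly q (-1)"
proof -
  have "poly q (-1) = (\<Sum>l\<le>n. coeff q l * (-1) ^ l)"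
    unfolding poly_altdef using assms
    by (intro sum.mono_neutral_left) (auto simp: coeff_eq_0)
  moreover have "(-1 :: 'a) ^ (n - l) = (-1) ^ n * (-1) ^ l" if "l \<le> n" for l
    using that by (simp add: power_add[symmetric] minus_one_power_iff)
  ultimately show ?thesis
    by (simp add: sum_distrib_left mult_ac)
qed

abbreviation shifted_cols_mat :: "nat \<Rightarrow> 'a :: comm_ring_1 poly \<Rightarrow> 'a mat" where
  "shifted_cols_mat n q \<equiv> mat (Suc n) (Suc n)
     (\<lambda>(i, j). if j < n then (if i = j \<or> i = Suc j then 1 else 0) else coeff q i)"

text \<open>Synthetic division of \<open>q\<close> by \<open>1 + x\<close> factors the matrix into triangular ones.\<close>

lemma det_shifted_cols_mat:
  fixes q :: "'a :: idom poly"
  assumes "degree q \<le> n"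
  shows "det (shifted_cols_mat n q) = (-1) ^ n * poly q (-1)"
proof -
  \<comment> \<open>The power series coefficients of q / (1 + x); \<open>u n\<close> becomes the
    only diagonal entry of \<open>?U\<close> that may differ from 1.\<close>
  define u where "u i = (\<Sum>l\<le>i. (-1) ^ (i - l) * coeff q l)" for i
  have u_Suc: "u (Suc i) + u i = coeff q (Suc i)" for i
    by (simp add: u_def Suc_diff_le sum_negf)
  have u_0: "u 0 = coeff q 0" by (simp add: u_def)
  let ?T = "mat (Suc n) (Suc n) (\<lambda>(i, j). if i = j \<or> i = Suc j then 1 else 0 :: 'a)"
  let ?U = "mat (Suc n) (Suc n) (\<lambda>(i, j). if j < n then (if i = j then 1 else 0) else u i)"
  have "shifted_cols_mat n q = ?T * ?U"
  proof (rule eq_matI)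
    fix i j assume "i < dim_row (?T * ?U)" "j < dim_col (?T * ?U)"
    then have ij: "i < Suc n" "j < Suc n" by auto
    have T: "(\<Sum>k<Suc n. (if i = k \<or> i = Suc k then 1 else 0) * g k) =
        (case i of 0 \<Rightarrow> g 0 | Suc i' \<Rightarrow> g i + g i')" for g :: "nat \<Rightarrow> 'a"
    proof (cases i)
      case 0
      then show ?thesis by (simp add: if_distrib[of "\<lambda>x. x * _"] cong: if_cong del: sum.lessThan_Suc)
    next
      case (Suc i')
      have "(\<Sum>k<Suc n. (if i = k \<or> i = Suc k then 1 else 0) * g k) =
          (\<Sum>k<Suc n. (if k = i then g k else 0) + (if k = i' then g k else 0))"
        using Suc by (intro sum.cong) auto
      then show ?thesis using Suc ij by (simp add: sum.distrib del: sum.lessThan_Suc)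
    qed
    show "shifted_cols_mat n q $$ (i, j) = (?T * ?U) $$ (i, j)"
      using ij T[of "\<lambda>k. if j < n then (if k = j then 1 else 0) else u k"]
      by (auto simp: scalar_prod_def atLeast0LessThan u_0 u_Suc split: nat.splits
          simp del: sum.lessThan_Suc)
  qed auto
  moreover have "det (?T * ?U) = det ?T * det ?U"
    by (rule det_mult) auto
  moreover have "det ?T = prod_list (diag_mat ?T)"
    by (rule det_lower_triangular[of "Suc n"]) auto
  then have "det ?T = 1"
    by (simp add: prod_list_diag_prod)
  moreover have "det ?U = prod_list (diag_mat ?U)"
    by (rule det_upper_triangular) (auto simp: upper_triangular_def)
  then have "det ?U = u n"
    by (simp add: prod_list_diag_prod atLeast0LessThan prod.lessThan_Suc)
  ultimately show ?thesis
    using alt_sum_coeff_eq_poly_minus_1[OF assms] by (simp add: u_def)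
qed

lemma det_moment_mat_mult_poly:
  assumes "degree q \<le> n"
  shows "det (moment_mat (Suc n)) * ((-1) ^ n * poly q (-1)) =
    det (mat (Suc n) (Suc n) (\<lambda>(i, j). if j < n then b (i + j) else moment (Suc n) i q))"
    (is "_ = det ?P")
proof -
  have "moment_mat (Suc n) * shifted_cols_mat n q = ?P"
  proof (rule eq_matI)
    fix i j assume "i < dim_row ?P" "j < dim_col ?P"
    then have ij: "i < Suc n" "j < Suc n" by auto
    have "(\<Sum>k<Suc n. laurent_coeff (i + k) 0 * (if k = j \<or> k = Suc j then 1 else 0)) = b (i + j)"
      if "j < n"
    proof -
      have "(\<Sum>k<Suc n. laurent_coeff (i + k) 0 * (if k = j \<or> k = Suc j then 1 else 0)) =
          (\<Sum>k<Suc n. (if k = j then laurent_coeff (i + k) 0 else 0) +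
            (if k = Suc j then laurent_coeff (i + k) 0 else 0))"
        by (intro sum.cong) auto
      then show ?thesis
        using that by (simp add: sum.distrib b_eq_laurent_coeff del: sum.lessThan_Suc)
    qed
    then show "(moment_mat (Suc n) * shifted_cols_mat n q) $$ (i, j) = ?P $$ (i, j)"
      using ij by (auto simp: scalar_prod_def moment_def atLeast0LessThan simp del: sum.lessThan_Suc)
  qed auto
  moreover have "det (moment_mat (Suc n) * shifted_cols_mat n q) =
      det (moment_mat (Suc n)) * det (shifted_cols_mat n q)"
    by (rule det_mult) auto
  ultimately show ?thesis
    using det_shifted_cols_mat[OF assms] by simp
qed

section \<open>Hankel determinants of \<open>b\<close>\<close>

lemma det_b_Suc:
  "det (mat (Suc n) (Suc n) (\<lambda>(i, j). b (i + j))) =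
     (-1) ^ (Suc n choose 2) * 2 ^ n * lucas (Suc n)" (is "?D = _")
proof -
  let ?m = "Suc n"
  let ?f = "\<lambda>i j. if j < ?m then b (i + j) else moment (Suc ?m) i (lucas_poly ?m)"
  have "det (moment_mat (Suc ?m)) * lucas ?m = det (mat (Suc ?m) (Suc ?m) (\<lambda>(i, j). ?f i j))"
    using det_moment_mat_mult_poly[OF degree_lucas_poly_le, of ?m]
    by (simp add: poly_lucas_poly_minus_1 del: lucas_poly.simps lucas.simps flip: power_add mult.assoc)
  also have "\<dots> = 2 * (-1) ^ ?m * (-1) ^ (?m + ?m) *
      det (mat ?m ?m (\<lambda>(i, j). ?f (if i < ?m then i else Suc i) j))"
    by (rule det_last_col_single)
      (auto simp: moment_lucas_poly laurent_coeff_diag laurent_coeff_eq_0 simp del: lucas_poly.simps)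
  also have "mat ?m ?m (\<lambda>(i, j). ?f (if i < ?m then i else Suc i) j) =
      mat ?m ?m (\<lambda>(i, j). b (i + j))"
    by (rule eq_matI) auto
  \<comment> \<open>The ratio of consecutive moment determinants equals the corner entry, so it
    cancels.\<close>
  finally have "(2 * (-1) ^ ?m) * (det (moment_mat ?m) * lucas ?m) = (2 * (-1) ^ ?m) * ?D"
    by (simp only: det_moment_mat_Suc mult.assoc) (simp flip: power_add mult.assoc)
  then have "det (moment_mat ?m) * lucas ?m = ?D" by simp
  then show ?thesis by (simp only: det_moment_mat)
qed

lemma det_b_shift:
  "det (mat n n (\<lambda>(i, j). b (i + j + 1))) =
     (-1) ^ ((n + 1) choose 2) * 2 ^ n * lucas (2 * (n div 2) + 1)"
proof -
  let ?q = "kernel_poly (n div 2)"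
  let ?f = "\<lambda>i j. if j < n then b (i + j) else moment (Suc n) i ?q"
  have "degree ?q \<le> n"
    using degree_kernel_poly_le[of "n div 2"] by simp
  then have "det (moment_mat (Suc n)) * ((-1) ^ n * lucas (2 * (n div 2) + 1)) =
      det (mat (Suc n) (Suc n) (\<lambda>(i, j). ?f i j))"
    using det_moment_mat_mult_poly[of ?q n] by (simp only: poly_kernel_poly_minus_1)
  \<comment> \<open>Deleting row 0 shifts the row index, turning b(i + j) into b(i + j + 1).\<close>
  also have "\<dots> = 1 * (-1) ^ (0 + n) *
      det (mat n n (\<lambda>(i, j). ?f (if i < 0 then i else Suc i) j))"
    by (rule det_last_col_single) (auto simp: moment_kernel_poly)
  also have "mat n n (\<lambda>(i, j). ?f (if i < 0 then i else Suc i) j) =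
      mat n n (\<lambda>(i, j). b (i + j + 1))"
    by (rule eq_matI) auto
  finally show ?thesis by (simp add: det_moment_mat)
qed

theorem theorem2p2:
  fixes n :: nat
  shows "rat_of_int (det (mat n n (\<lambda>(i, j). b (i + j))))
           = (-1) ^ (n choose 2) * 2 powi (int n - 1) * rat_of_int (lucas n)
       \<and> det (mat n n (\<lambda>(i, j). b (i + j + 1)))
           = (-1) ^ ((n + 1) choose 2) * 2 ^ n * lucas (2 * (n div 2) + 1)"
proof (intro conjI det_b_shift)
  show "rat_of_int (det (mat n n (\<lambda>(i, j). b (i + j))))
      = (-1) ^ (n choose 2) * 2 powi (int n - 1) * rat_of_int (lucas n)"
  proof (cases n)
    case 0
    \<comment> \<open>The only negative exponent: the empty determinant is
      \<open>2 powi (-1) * 2 = 1\<close>.\<close>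
    then show ?thesis by (simp add: det_dim_zero power_int_minus binomial_eq_0)
  next
    case (Suc m)
    then show ?thesis by (simp only: det_b_Suc) simp
  qed
qed

end
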